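(* There exist two families $(P_{k})_{k \ge 1}$ and $(Q_{k})_{k \ge 1}$ of finite convexly independent subsets of $\mathbb{R}^{2}$ such that $|P_{k}| = |Q_{k}| = 2^{k}$ and $\mathrm{ci}(P_{k} + Q_{k}) \ge (k+2)2^{k-1}$ for all $k \ge 1$.
   Context: A finite set $C \subset \mathbb{R}^2$ is convexly independent if its points are the vertices of a convex polygon, i.e. $\mathrm{conv}(C)$ has exactly $|C|$ vertices. For a finite set $X \subset \mathbb{R}^2$, $\mathrm{ci}(X)$ denotes the largest size of a convexly independent subset of $X$. For sets $P, Q \subset \mathbb{R}^2$, $P+Q = \{p+q : p \in P, q \in Q\}$ is the Minkowski sum. *)

theory Defs
  imports "HOL-Analysis.Analysis" "HOL-Library.Set_Algebras"
begin

text \<open>Degenerate polygons are admitted: the empty set, singletons and pairs of points are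
  convexly independent.\<close>

definition convexly_independent :: "(real ^ 2) set \<Rightarrow> bool" where
  "convexly_independent C \<longleftrightarrow>
     finite C \<and> card {v. v extreme_point_of (convex hull C)} = card C"

text \<open>Meaningful for finite \<open>X\<close> only, as \<open>Max\<close> is unspecified on infinite sets.\<close>

definition ci :: "(real ^ 2) set \<Rightarrow> nat" where
  "ci X = Max {card C | C. C \<subseteq> X \<and> convexly_independent C}"

end

theory Submission
  imports Defs
begin

text \<open>
  The polygons are doubled recursively. Let \<open>p\<^sub>i = (x\<^sub>i, f\<^sub>i)\<close> and
  \<open>q\<^sub>i = (x\<^sub>i, g\<^sub>i)\<close> be lower convex chains with common abscissae, and let \<open>E\<close> be a set of
  index pairs containing the diagonal such that the sums \<open>p\<^sub>i + q\<^sub>j\<close>, \<open>(i, j) \<in> E\<close>, form a lower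
  convex chain. Append to both chains copies of themselves under a shear by a very large slope \<open>c\<close>,
  translated by \<open>(L, 3cL/4)\<close> and \<open>(L, cL/4)\<close> respectively, with \<open>L\<close> large; \<open>c = 16N\<close> and
  \<open>L = 100N\<close> suffice if \<open>N \<ge> 1\<close> bounds all coordinates and slopes. Up to bounded errors, the
  new chains consist of a part of slope 0, an edge of slope \<open>3c/4\<close> or \<open>c/4\<close>, and a part of slope \<open>c\<close>.
  Because of the common abscissae, the sums of \<open>p\<^sub>i\<close> and the copy of \<open>q\<^sub>i\<close> form a translate of the
  diagonal chain sheared by \<open>c/2\<close>, and this fits between the two copies of the old chain of sums,
  the connecting edges having slopes \<open>c/4\<close> and \<open>3c/4\<close>. Thus the number of selected
  sums satisfies \<open>e(k+1) = 2 e(k) + 2^k\<close> with \<open>e(0) = 1\<close>.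
\<close>

section \<open>Lower convex chains described by supporting lines\<close>

text \<open>Strict lower convex position, encoded by supporting lines with slopes confined to
  \<open>{a..b}\<close>. The labels need no ordering, and distinct labels automatically carry
  distinct points.\<close>

definition lower_exposed :: "'a set \<Rightarrow> ('a \<Rightarrow> real) \<Rightarrow> ('a \<Rightarrow> real) \<Rightarrow> real \<Rightarrow> real \<Rightarrow> bool" where
  "lower_exposed I X Y a b \<longleftrightarrow>
     (\<forall>i\<in>I. \<exists>t\<in>{a..b}. \<forall>j\<in>I. j \<noteq> i \<longrightarrow> Y i - t * X i < Y j - t * X j)"

definition slopes_between ::
  "'a set \<Rightarrow> 'a set \<Rightarrow> ('a \<Rightarrow> real) \<Rightarrow> ('a \<Rightarrow> real) \<Rightarrow> real \<Rightarrow> real \<Rightarrow> bool" where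
  "slopes_between I J X Y b c \<longleftrightarrow>
     (\<forall>i\<in>I. \<forall>j\<in>J. X i < X j \<and> b * (X j - X i) < Y j - Y i \<and> Y j - Y i < c * (X j - X i))"

lemma slopes_between_less_left:
  assumes "slopes_between I J X Y b c" "i \<in> I" "j \<in> J" "t \<le> b"
  shows "Y i - t * X i < Y j - t * X j"
proof -
  have "X i < X j" "b * (X j - X i) < Y j - Y i"
    using assms unfolding slopes_between_def by auto
  moreover have "t * (X j - X i) \<le> b * (X j - X i)"
    using \<open>X i < X j\<close> \<open>t \<le> b\<close> by (intro mult_right_mono) auto
  ultimately show ?thesis by (simp add: right_diff_distrib)
qed

lemma slopes_between_less_right:
  assumes "slopes_between I J X Y b c" "i \<in> I" "j \<in> J" "c \<le> t"
  shows "Y j - t * X j < Y i - t * X i"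
proof -
  have "X i < X j" "Y j - Y i < c * (X j - X i)"
    using assms unfolding slopes_between_def by auto
  moreover have "c * (X j - X i) \<le> t * (X j - X i)"
    using \<open>X i < X j\<close> \<open>c \<le> t\<close> by (intro mult_right_mono) auto
  ultimately show ?thesis by (simp add: right_diff_distrib)
qed

lemma lower_exposed_mono:
  assumes "lower_exposed I X Y a b" "J \<subseteq> I" "a' \<le> a" "b \<le> b'"
  shows "lower_exposed J X Y a' b'"
  unfolding lower_exposed_def
proof
  fix i assume "i \<in> J"
  then obtain t where "t \<in> {a..b}" "\<forall>j\<in>I. j \<noteq> i \<longrightarrow> Y i - t * X i < Y j - t * X j"
    using assms unfolding lower_exposed_def by blast
  with assms show "\<exists>t\<in>{a'..b'}. \<forall>j\<in>J. j \<noteq> i \<longrightarrow> Y i - t * X i < Y j - t * X j"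
    by (intro bexI[of _ t]) auto
qed

text \<open>A line of slope at most \<open>b\<close> supporting the left part passes below the right
  part, since all connecting segments are steeper than \<open>b\<close>. Symmetrically, lines of
  slope at least \<open>a'\<close> supporting the right part pass below the left part.\<close>

lemma lower_exposed_Un:
  assumes "lower_exposed I X Y a b" "lower_exposed J X Y a' b'"
    and "slopes_between I J X Y b a'" "a \<le> a'" "b \<le> b'"
  shows "lower_exposed (I \<union> J) X Y a b'"
  unfolding lower_exposed_def
proof
  fix i assume "i \<in> I \<union> J"
  then show "\<exists>t\<in>{a..b'}. \<forall>j\<in>I \<union> J. j \<noteq> i \<longrightarrow> Y i - t * X i < Y j - t * X j"
  proof
    assume i: "i \<in> I"
    then obtain t where t: "t \<in> {a..b}" "\<forall>j\<in>I. j \<noteq> i \<longrightarrow> Y i - t * X i < Y j - t * X j"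
      using assms(1) unfolding lower_exposed_def by blast
    then show ?thesis
      using slopes_between_less_left[OF assms(3) i] assms(5) by (intro bexI[of _ t]) auto
  next
    assume i: "i \<in> J"
    then obtain t where t: "t \<in> {a'..b'}" "\<forall>j\<in>J. j \<noteq> i \<longrightarrow> Y i - t * X i < Y j - t * X j"
      using assms(2) unfolding lower_exposed_def by blast
    then show ?thesis
      using slopes_between_less_right[OF assms(3) _ i] assms(4) by (intro bexI[of _ t]) auto
  qed
qed

text \<open>Applying \<open>lower_exposed_Un\<close> twice would ask too much of the segments from
  \<open>I\<close> to \<open>K\<close>: slopes above \<open>b'\<close>, or below \<open>a'\<close>.
  In the doubling these slopes are near \<open>8 * N\<close>, whereas \<open>a' = 7 * N\<close> and
  \<open>b' = 9 * N\<close>. The weaker bounds \<open>b\<close> and \<open>a''\<close> suffice,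
  because points of \<open>I\<close> and \<open>K\<close> use only supporting slopes up to
  \<open>b\<close> and from \<open>a''\<close> on.\<close>

lemma lower_exposed_Un3:
  assumes I: "lower_exposed I X Y a b" and J: "lower_exposed J X Y a' b'"
    and K: "lower_exposed K X Y a'' b''"
    and IJ: "slopes_between I J X Y b a'" and JK: "slopes_between J K X Y b' a''"
    and IK: "slopes_between I K X Y b a''"
    and le: "a \<le> a'" "a' \<le> a''" "b \<le> b'" "b' \<le> b''"
  shows "lower_exposed (I \<union> J \<union> K) X Y a b''"
  unfolding lower_exposed_def
proof
  fix i assume "i \<in> I \<union> J \<union> K"
  then consider "i \<in> I" | "i \<in> J" | "i \<in> K" by blast
  then show "\<exists>t\<in>{a..b''}. \<forall>j\<in>I \<union> J \<union> K. j \<noteq> i \<longrightarrow> Y i - t * X i < Y j - t * X j"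
  proof cases
    case 1
    then obtain t where "t \<in> {a..b}" "\<forall>j\<in>I. j \<noteq> i \<longrightarrow> Y i - t * X i < Y j - t * X j"
      using I unfolding lower_exposed_def by blast
    then show ?thesis
      using slopes_between_less_left[OF IJ 1] slopes_between_less_left[OF IK 1] le
      by (intro bexI[of _ t]) auto
  next
    case 2
    then obtain t where "t \<in> {a'..b'}" "\<forall>j\<in>J. j \<noteq> i \<longrightarrow> Y i - t * X i < Y j - t * X j"
      using J unfolding lower_exposed_def by blast
    then show ?thesis
      using slopes_between_less_right[OF IJ _ 2] slopes_between_less_left[OF JK 2] le
      by (intro bexI[of _ t]) auto
  next
    case 3
    then obtain t where "t \<in> {a''..b''}" "\<forall>j\<in>K. j \<noteq> i \<longrightarrow> Y i - t * X i < Y j - t * X j"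
      using K unfolding lower_exposed_def by blast
    then show ?thesis
      using slopes_between_less_right[OF JK _ 3] slopes_between_less_right[OF IK _ 3] le
      by (intro bexI[of _ t]) auto
  qed
qed

text \<open>A shear by \<open>c\<close> turns supporting lines of slope \<open>t\<close> into
  supporting lines of slope \<open>t + c\<close>, and a translation keeps slopes. The map
  \<open>h\<close> gives the copy its new labels.\<close>

lemma lower_exposed_shear_image:
  assumes "lower_exposed I X Y a b"
    and "\<And>i. i \<in> I \<Longrightarrow> X' (h i) = X i + u"
    and "\<And>i. i \<in> I \<Longrightarrow> Y' (h i) = Y i + c * X i + v"
  shows "lower_exposed (h ` I) X' Y' (a + c) (b + c)"
  unfolding lower_exposed_def
proof
  fix i' assume "i' \<in> h ` I"
  then obtain i where i: "i \<in> I" "i' = h i" by blast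
  with assms(1) obtain t where
    t: "t \<in> {a..b}" "\<And>j. j \<in> I \<Longrightarrow> j \<noteq> i \<Longrightarrow> Y i - t * X i < Y j - t * X j"
    unfolding lower_exposed_def by blast
  have "Y' i' - (t + c) * X' i' < Y' j' - (t + c) * X' j'" if j': "j' \<in> h ` I" "j' \<noteq> i'" for j'
  proof -
    obtain j where j: "j \<in> I" "j' = h j" "j \<noteq> i" using j' i by blast
    show ?thesis using t(2)[OF j(1,3)] i j by (simp add: assms(2,3) algebra_simps)
  qed
  with t(1) show "\<exists>t\<in>{a + c..b + c}. \<forall>j\<in>h ` I. j \<noteq> i' \<longrightarrow> Y' i' - t * X' i' < Y' j - t * X' j"
    by (intro bexI[of _ "t + c"]) auto
qed

section \<open>From exposed chains to convexly independent sets\<close>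

lemma inj_on_lower_exposed:
  assumes "lower_exposed I X Y a b"
  shows "inj_on (\<lambda>i. vector [X i, Y i] :: real ^ 2) I"
proof (rule inj_onI)
  fix i j assume "i \<in> I" "j \<in> I" and "(vector [X i, Y i] :: real ^ 2) = vector [X j, Y j]"
  then have "X i = X j" "Y i = Y j" by (metis vector_2(1), metis vector_2(2))
  with assms \<open>i \<in> I\<close> \<open>j \<in> I\<close> show "i = j" unfolding lower_exposed_def by fastforce
qed

text \<open>The functional \<open>(- t, 1)\<close> puts all other points into an open half-plane
  whose boundary passes through the given point, which is therefore outside their hull and
  extreme.\<close>

lemma convexly_independent_lower_exposed:
  assumes "finite I" "lower_exposed I X Y a b"
  shows "convexly_independent ((\<lambda>i. vector [X i, Y i]) ` I)"
proof -
  define C where "C = (\<lambda>i. vector [X i, Y i] :: real ^ 2) ` I"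
  have fin: "finite C" using assms(1) by (simp add: C_def)
  have "z extreme_point_of (convex hull C)" if z: "z \<in> C" for z
  proof -
    obtain i where i: "i \<in> I" "z = vector [X i, Y i]" using z by (auto simp: C_def)
    obtain t where t: "\<And>j. j \<in> I \<Longrightarrow> j \<noteq> i \<Longrightarrow> Y i - t * X i < Y j - t * X j"
      using assms(2) i unfolding lower_exposed_def by blast
    define u where "u = (vector [- t, 1] :: real ^ 2)"
    have u: "u \<bullet> vector [p, q] = q - t * p" for p q
      by (simp add: u_def inner_vec_def sum_2 vector_2)
    have "C - {z} \<subseteq> {w. u \<bullet> w > u \<bullet> z}"
    proof
      fix w assume "w \<in> C - {z}"
      then obtain j where "j \<in> I" "j \<noteq> i" "w = vector [X j, Y j]" by (auto simp: C_def i)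
      then show "w \<in> {w. u \<bullet> w > u \<bullet> z}" using t by (simp add: i u)
    qed
    then have "convex hull (C - {z}) \<subseteq> {w. u \<bullet> w > u \<bullet> z}"
      by (intro hull_minimal convex_halfspace_gt) auto
    then have "z \<notin> convex hull (C - {z})" by blast
    then have "z extreme_point_of (convex hull (insert z (C - {z})))"
      using fin by (intro extreme_point_of_convex_hull_insert) auto
    then show ?thesis using z by (simp add: insert_absorb)
  qed
  then have "{v. v extreme_point_of (convex hull C)} = C"
    using extreme_point_of_convex_hull by blast
  then show ?thesis using fin unfolding convexly_independent_def C_def by simp
qed

section \<open>The recursive doubling\<close>

text \<open>A single \<open>N\<close> bounds coordinates and slopes. Having the diagonal inside
  \<open>E\<close> lets the middle part of the next stage inherit its exposedness from
  \<open>E\<close>.\<close>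

definition chain_system ::
  "nat \<Rightarrow> real \<Rightarrow> (nat \<Rightarrow> real) \<Rightarrow> (nat \<Rightarrow> real) \<Rightarrow> (nat \<Rightarrow> real) \<Rightarrow> (nat \<times> nat) set \<Rightarrow> bool" where
  "chain_system n N x f g E \<longleftrightarrow>
     N \<ge> 1 \<and> (\<forall>i<n. \<bar>x i\<bar> \<le> N \<and> \<bar>f i\<bar> \<le> N \<and> \<bar>g i\<bar> \<le> N) \<and>
     lower_exposed {..<n} x f (-N) N \<and> lower_exposed {..<n} x g (-N) N \<and>
     lower_exposed E (\<lambda>(i, j). x i + x j) (\<lambda>(i, j). f i + g j) (-N) N \<and>
     E \<subseteq> {..<n} \<times> {..<n} \<and> (\<forall>i<n. (i, i) \<in> E)"

lemma chain_system_double: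
  assumes "chain_system n N x f g E"
  shows "\<exists>N' x' f' g' E'. chain_system (2 * n) N' x' f' g' E' \<and> card E' = 2 * card E + n"
proof -
  have N: "N \<ge> 1"
    and bound: "\<And>i. i < n \<Longrightarrow> \<bar>x i\<bar> \<le> N \<and> \<bar>f i\<bar> \<le> N \<and> \<bar>g i\<bar> \<le> N"
    and P: "lower_exposed {..<n} x f (-N) N" and Q: "lower_exposed {..<n} x g (-N) N"
    and C: "lower_exposed E (\<lambda>(i, j). x i + x j) (\<lambda>(i, j). f i + g j) (-N) N"
    and E: "E \<subseteq> {..<n} \<times> {..<n}" and diag: "\<And>i. i < n \<Longrightarrow> (i, i) \<in> E"
    using assms unfolding chain_system_def by auto
  define x' where "x' i = (if i < n then x i else x (i - n) + 100 * N)" for i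
  \<comment> \<open>With \<open>c = 16 * N\<close> and \<open>L = 100 * N\<close>, the offsets are
    \<open>3 * c * L / 4\<close> here and \<open>c * L / 4\<close> for \<open>g'\<close>. The
    connecting edges get slopes near \<open>12 * N\<close> and \<open>4 * N\<close>, between the
    ranges \<open>[-N, N]\<close> and \<open>[15 * N, 17 * N]\<close> of the two halves.\<close>
  define f' where "f' i = (if i < n then f i
    else f (i - n) + 16 * N * x (i - n) + 1200 * (N * N))" for i
  define g' where "g' i = (if i < n then g i
    else g (i - n) + 16 * N * x (i - n) + 400 * (N * N))" for i
  \<comment> \<open>Of the two kinds of mixed sums only this one is selected: the sum for
    \<open>(n + i, i)\<close> has the same abscissa but lies higher.\<close>
  define E1 where "E1 = (\<lambda>i. (i, n + i)) ` {..<n}"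
  define E2 where "E2 = (\<lambda>(i, j). (n + i, n + j)) ` E"
  define X where "X = (\<lambda>(i, j). x i + x j)"
  define Y where "Y = (\<lambda>(i, j). f i + g j)"
  define X' where "X' = (\<lambda>(i, j). x' i + x' j)"
  define Y' where "Y' = (\<lambda>(i, j). f' i + g' j)"
  \<comment> \<open>A generous bound: coordinates stay below \<open>1217 * (N * N)\<close> in
    absolute value up to equality, and slopes below \<open>17 * N\<close> likewise.\<close>
  define N' where "N' = 2000 * (N * N)"
  have NN: "N \<le> N * N" using N by simp
  have low: "x' i = x i" "f' i = f i" "g' i = g i" if "i < n" for i
    using that by (simp_all add: x'_def f'_def g'_def)
  have high: "x' (n + i) = x i + 100 * N"
    "f' (n + i) = f i + 16 * N * x i + 1200 * (N * N)"
    "g' (n + i) = g i + 16 * N * x i + 400 * (N * N)" for i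
    by (simp_all add: x'_def f'_def g'_def)
  \<comment> \<open>With all bounds in terms of \<open>N * N\<close>, the slope inequalities below
    become linear in \<open>N * N\<close>, \<open>N * x i\<close> and the coordinates.\<close>
  have bnd: "x i \<le> N" "- N \<le> x i" "f i \<le> N * N" "- (N * N) \<le> f i"
    "g i \<le> N * N" "- (N * N) \<le> g i" "N * x i \<le> N * N" "- (N * N) \<le> N * x i" if "i < n" for i
  proof -
    have "\<bar>N * x i\<bar> \<le> N * N"
      using bound[OF that] N by (auto simp: abs_mult intro: mult_left_mono)
    then show "x i \<le> N" "- N \<le> x i" "f i \<le> N * N" "- (N * N) \<le> f i"
      "g i \<le> N * N" "- (N * N) \<le> g i" "N * x i \<le> N * N" "- (N * N) \<le> N * x i"
      using bound[OF that] NN by linarith+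
  qed
  have split: "{..<2*n} = {..<n} \<union> (+) n ` {..<n}"
  proof -
    have "i \<in> (+) n ` {..<n}" if "i < 2 * n" "\<not> i < n" for i
      using that by (intro image_eqI[of _ _ "i - n"]) auto
    then show ?thesis by auto
  qed
  have bound': "\<bar>x' i\<bar> \<le> N' \<and> \<bar>f' i\<bar> \<le> N' \<and> \<bar>g' i\<bar> \<le> N'" if "i < 2 * n" for i
  proof -
    from that consider "i < n" | j where "j < n" "i = n + j" using split by auto
    then show ?thesis
    proof cases
      case 1
      then show ?thesis unfolding low[OF 1] N'_def using bnd[OF 1] NN N by linarith
    next
      case (2 j)
      show ?thesis unfolding 2(2) high N'_def mult.assoc using bnd[OF 2(1)] NN N by linarith
    qed
  qed
  have P': "lower_exposed ({..<n} \<union> (+) n ` {..<n}) x' f' (-N) (N + 16 * N)"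
  proof (rule lower_exposed_Un)
    show "lower_exposed {..<n} x' f' (-N) N"
      using lower_exposed_shear_image[OF P, of x' id 0 f' 0 0] by (simp add: low)
    show "lower_exposed ((+) n ` {..<n}) x' f' (- N + 16 * N) (N + 16 * N)"
      by (rule lower_exposed_shear_image[OF P]) (simp_all add: high)
    show "slopes_between {..<n} ((+) n ` {..<n}) x' f' N (- N + 16 * N)"
      unfolding slopes_between_def
    proof safe
      fix i j assume ij: "i < n" "j < n"
      note b = bnd[OF ij(1)] bnd[OF ij(2)]
      show "x' i < x' (n + j)" using b N ij by (simp add: low high)
      show "N * (x' (n + j) - x' i) < f' (n + j) - f' i"
        by (simp only: low ij high, simp add: algebra_simps, use b N NN in linarith)
      show "f' (n + j) - f' i < (- N + 16 * N) * (x' (n + j) - x' i)"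
        by (simp only: low ij high, simp add: algebra_simps, use b N NN in linarith)
    qed
  qed (use N in auto)
  have Q': "lower_exposed ({..<n} \<union> (+) n ` {..<n}) x' g' (-N) (N + 16 * N)"
  proof (rule lower_exposed_Un)
    show "lower_exposed {..<n} x' g' (-N) N"
      using lower_exposed_shear_image[OF Q, of x' id 0 g' 0 0] by (simp add: low)
    show "lower_exposed ((+) n ` {..<n}) x' g' (- N + 16 * N) (N + 16 * N)"
      by (rule lower_exposed_shear_image[OF Q]) (simp_all add: high)
    show "slopes_between {..<n} ((+) n ` {..<n}) x' g' N (- N + 16 * N)"
      unfolding slopes_between_def
    proof safe
      fix i j assume ij: "i < n" "j < n"
      note b = bnd[OF ij(1)] bnd[OF ij(2)]
      show "x' i < x' (n + j)" using b N ij by (simp add: low high)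
      show "N * (x' (n + j) - x' i) < g' (n + j) - g' i"
        by (simp only: low ij high, simp add: algebra_simps, use b N NN in linarith)
      show "g' (n + j) - g' i < (- N + 16 * N) * (x' (n + j) - x' i)"
        by (simp only: low ij high, simp add: algebra_simps, use b N NN in linarith)
    qed
  qed (use N in auto)
  \<comment> \<open>The supporting slopes of the three parts lie within \<open>N\<close> of
    \<open>0\<close>, \<open>8 * N\<close> and \<open>16 * N\<close>; the edges joining consecutive
    parts have slopes near \<open>4 * N\<close> and \<open>12 * N\<close>.\<close>
  have C': "lower_exposed (E \<union> E1 \<union> E2) X' Y' (-N) (N + 16 * N)"
  proof (rule lower_exposed_Un3)
    have C0: "lower_exposed E X Y (-N) N" using C by (simp add: X_def Y_def)
    have D0: "lower_exposed ((\<lambda>i. (i, i)) ` {..<n}) X Y (-N) N"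
      by (rule lower_exposed_mono[OF C0]) (use diag in auto)
    have E1: "E1 = (\<lambda>(i, j). (i, n + j)) ` (\<lambda>i. (i, i)) ` {..<n}"
      unfolding E1_def by (simp add: image_image)
    show "lower_exposed E X' Y' (-N) N"
      using lower_exposed_shear_image[OF C0, of X' id 0 Y' 0 0] E
      by (force simp: low X_def X'_def Y_def Y'_def)
    \<comment> \<open>Only one summand is sheared by \<open>16 * N\<close>, but both have abscissa
      \<open>x i\<close>, so the term \<open>16 * N * x i\<close> equals \<open>8 * N\<close> times
      the abscissa \<open>2 * x i\<close> of the diagonal sum.\<close>
    show "lower_exposed E1 X' Y' (- N + 8 * N) (N + 8 * N)"
      unfolding E1
      by (rule lower_exposed_shear_image[OF D0, where u = "100 * N" and v = "400 * (N * N)"])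
        (auto simp: low high X_def X'_def Y_def Y'_def)
    show "lower_exposed E2 X' Y' (- N + 16 * N) (N + 16 * N)"
      unfolding E2_def
      by (rule lower_exposed_shear_image[OF C0, where u = "200 * N" and v = "1600 * (N * N)"])
        (auto simp: high X_def X'_def Y_def Y'_def distrib_left)
    show "slopes_between E E1 X' Y' N (- N + 8 * N)"
      unfolding slopes_between_def
    proof (intro ballI)
      fix e e' assume "e \<in> E" "e' \<in> E1"
      then obtain i j m where e: "e = (i, j)" "e' = (m, n + m)" and ij: "i < n" "j < n" "m < n"
        using E unfolding E1_def by auto
      note b = bnd[OF ij(1)] bnd[OF ij(2)] bnd[OF ij(3)]
      show "X' e < X' e' \<and> N * (X' e' - X' e) < Y' e' - Y' e \<and>
          Y' e' - Y' e < (- N + 8 * N) * (X' e' - X' e)"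
        by (simp only: e X'_def Y'_def prod.case low ij high, simp add: algebra_simps,
            use b N NN in \<open>intro conjI; linarith\<close>)
    qed
    show "slopes_between E1 E2 X' Y' (N + 8 * N) (- N + 16 * N)"
      unfolding slopes_between_def
    proof (intro ballI)
      fix e' e assume "e \<in> E2" "e' \<in> E1"
      then obtain i j m where e: "e = (n + i, n + j)" "e' = (m, n + m)"
          and ij: "i < n" "j < n" "m < n"
        using E unfolding E1_def E2_def by auto
      note b = bnd[OF ij(1)] bnd[OF ij(2)] bnd[OF ij(3)]
      show "X' e' < X' e \<and> (N + 8 * N) * (X' e - X' e') < Y' e - Y' e' \<and>
          Y' e - Y' e' < (- N + 16 * N) * (X' e - X' e')"
        by (simp only: e X'_def Y'_def prod.case low ij high, simp add: algebra_simps,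
            use b N NN in \<open>intro conjI; linarith\<close>)
    qed
    show "slopes_between E E2 X' Y' N (- N + 16 * N)"
      unfolding slopes_between_def
    proof (intro ballI)
      fix e' e assume "e \<in> E2" "e' \<in> E"
      then obtain i j m l where e: "e = (n + i, n + j)" "e' = (m, l)"
          and ij: "i < n" "j < n" "m < n" "l < n"
        using E unfolding E2_def by (cases e') auto
      note b = bnd[OF ij(1)] bnd[OF ij(2)] bnd[OF ij(3)] bnd[OF ij(4)]
      show "X' e' < X' e \<and> N * (X' e - X' e') < Y' e - Y' e' \<and>
          Y' e - Y' e' < (- N + 16 * N) * (X' e - X' e')"
        by (simp only: e X'_def Y'_def prod.case low ij high, simp add: algebra_simps,
            use b N NN in \<open>intro conjI; linarith\<close>)
    qed
  qed (use N in auto)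
  have N': "-N' \<le> -N" "N + 16 * N \<le> N'" "1 \<le> N'" unfolding N'_def using N NN by linarith+
  have finE: "finite E" using E by (rule finite_subset) simp
  have cE1: "card E1 = n" unfolding E1_def by (subst card_image) (auto simp: inj_on_def)
  have cE2: "card E2 = card E" unfolding E2_def by (subst card_image) (auto simp: inj_on_def)
  have "card (E \<union> E1 \<union> E2) = card (E \<union> E1) + card E2"
    using finE E by (intro card_Un_disjoint) (auto simp: E1_def E2_def)
  also have "card (E \<union> E1) = card E + card E1"
    using finE E by (intro card_Un_disjoint) (auto simp: E1_def)
  finally have card: "card (E \<union> E1 \<union> E2) = 2 * card E + n" by (simp add: cE1 cE2)
  have diag': "(i, i) \<in> E \<union> E1 \<union> E2" if "i < 2 * n" for i
  proof -
    from that consider "i < n" | j where "j < n" "i = n + j" using split by auto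
    then show ?thesis
    proof cases
      case 1
      then show ?thesis using diag by blast
    next
      case (2 j)
      then have "(i, i) = (\<lambda>(i, j). (n + i, n + j)) (j, j)" by simp
      then show ?thesis unfolding E2_def using diag[OF 2(1)] by blast
    qed
  qed
  have sub: "E \<union> E1 \<union> E2 \<subseteq> {..<2*n} \<times> {..<2*n}"
    using E by (auto simp: E1_def E2_def)
  have "chain_system (2 * n) N' x' f' g' (E \<union> E1 \<union> E2)"
    unfolding chain_system_def
  proof (intro conjI allI impI)
    show "lower_exposed {..<2*n} x' f' (-N') N'"
      unfolding split by (rule lower_exposed_mono[OF P' order.refl N'(1,2)])
    show "lower_exposed {..<2*n} x' g' (-N') N'"
      unfolding split by (rule lower_exposed_mono[OF Q' order.refl N'(1,2)])
    show "lower_exposed (E \<union> E1 \<union> E2) (\<lambda>(i, j). x' i + x' j) (\<lambda>(i, j). f' i + g' j) (-N') N'"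
      using lower_exposed_mono[OF C' order.refl N'(1,2)] unfolding X'_def Y'_def .
  qed (use bound' N'(3) sub diag' in blast)+
  with card show ?thesis by blast
qed

text \<open>The recursion \<open>e(k+1) = 2 e(k) + 2^k\<close> is solved here, with the factor 2
  clearing the denominator so that the induction can start from a single point at
  \<open>k = 0\<close>.\<close>

lemma chain_system_exists:
  "\<exists>N x f g E. chain_system (2 ^ k) N x f g E \<and> 2 * card E = (k + 2) * 2 ^ k"
proof (induction k)
  case 0
  have "chain_system 1 1 (\<lambda>_. 0) (\<lambda>_. 0) (\<lambda>_. 0) {(0, 0)}"
    by (auto simp: chain_system_def lower_exposed_def intro!: exI[of _ 0])
  moreover have "2 * card {(0 :: nat, 0 :: nat)} = (0 + 2) * 2 ^ 0" by simp
  ultimately show ?case unfolding power_0 by blast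
next
  case (Suc k)
  then obtain N x f g E where E: "chain_system (2 ^ k) N x f g E" "2 * card E = (k + 2) * 2 ^ k"
    by blast
  obtain N' x' f' g' E' where
    E': "chain_system (2 * 2 ^ k) N' x' f' g' E'" "card E' = 2 * card E + 2 ^ k"
    using chain_system_double[OF E(1)] by blast
  have "2 * card E' = (Suc k + 2) * (2 * 2 ^ k)"
    using E(2) E'(2) by simp
  with E'(1) show ?case unfolding power_Suc by blast
qed

section \<open>The bound on \<open>ci\<close> and the two families\<close>

lemma ci_ge:
  assumes "finite X" "C \<subseteq> X" "convexly_independent C"
  shows "card C \<le> ci X"
  unfolding ci_def
proof (rule Max_ge)
  have "{card C |C. C \<subseteq> X \<and> convexly_independent C} \<subseteq> card ` Pow X" by auto
  then show "finite {card C |C. C \<subseteq> X \<and> convexly_independent C}"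
    by (rule finite_subset) (use assms(1) in simp)
qed (use assms in auto)

theorem theorem1p1:
  shows "\<exists>P Q :: nat \<Rightarrow> (real ^ 2) set. \<forall>k\<ge>1.
           finite (P k) \<and> convexly_independent (P k) \<and>
           finite (Q k) \<and> convexly_independent (Q k) \<and>
           card (P k) = 2 ^ k \<and> card (Q k) = 2 ^ k \<and>
           ci (P k + Q k) \<ge> (k + 2) * 2 ^ (k - 1)"
proof -
  have "\<exists>P Q :: (real ^ 2) set.
           finite P \<and> convexly_independent P \<and> finite Q \<and> convexly_independent Q \<and>
           card P = 2 ^ k \<and> card Q = 2 ^ k \<and> ci (P + Q) \<ge> (k + 2) * 2 ^ (k - 1)"
    if "k \<ge> 1" for k
  proof -
    obtain N x f g E where "chain_system (2 ^ k) N x f g E"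
      and card: "2 * card E = (k + 2) * 2 ^ k"
      using chain_system_exists[of k] by blast
    then have P: "lower_exposed {..<2^k} x f (-N) N" and Q: "lower_exposed {..<2^k} x g (-N) N"
      and C: "lower_exposed E (\<lambda>(i, j). x i + x j) (\<lambda>(i, j). f i + g j) (-N) N"
      and E: "E \<subseteq> {..<2^k} \<times> {..<2^k}"
      unfolding chain_system_def by blast+
    define p where "p = (\<lambda>i. vector [x i, f i] :: real ^ 2)"
    define q where "q = (\<lambda>i. vector [x i, g i] :: real ^ 2)"
    define r where
      "r = (\<lambda>e. vector [(case e of (i, j) \<Rightarrow> x i + x j), (case e of (i, j) \<Rightarrow> f i + g j)] :: real ^ 2)"
    have r: "r (i, j) = p i + q j" for i j
      by (simp add: r_def p_def q_def vec_eq_iff forall_2 vector_2)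
    have finE: "finite E" using E by (rule finite_subset) simp
    have "r ` E \<subseteq> p ` {..<2^k} + q ` {..<2^k}"
    proof clarify
      fix i j assume "(i, j) \<in> E"
      then have "i \<in> {..<2^k}" "j \<in> {..<2^k}" using E by auto
      then show "r (i, j) \<in> p ` {..<2^k} + q ` {..<2^k}"
        unfolding r by (intro set_plus_intro imageI)
    qed
    moreover have "convexly_independent (r ` E)"
      using convexly_independent_lower_exposed[OF finE C] by (simp add: r_def)
    moreover have "finite (p ` {..<2^k} + q ` {..<2^k})"
      by (intro finite_set_plus) auto
    ultimately have "card (r ` E) \<le> ci (p ` {..<2^k} + q ` {..<2^k})"
      by (intro ci_ge)
    \<comment> \<open>Strict exposedness of the sums rules out that two selected pairs give the same
      point.\<close>
    moreover have "card (r ` E) = card E"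
      using inj_on_lower_exposed[OF C] unfolding r_def by (rule card_image)
    moreover have "card E = (k + 2) * 2 ^ (k - 1)"
      using card that by (cases k) auto
    moreover have "card (p ` {..<2^k}) = 2 ^ k"
      using card_image[OF inj_on_lower_exposed[OF P]] by (simp add: p_def)
    moreover have "card (q ` {..<2^k}) = 2 ^ k"
      using card_image[OF inj_on_lower_exposed[OF Q]] by (simp add: q_def)
    moreover have "convexly_independent (p ` {..<2^k})" "convexly_independent (q ` {..<2^k})"
      using convexly_independent_lower_exposed[OF _ P] convexly_independent_lower_exposed[OF _ Q]
      by (simp_all add: p_def q_def)
    ultimately show ?thesis
      by (intro exI[of _ "p ` {..<2^k}"] exI[of _ "q ` {..<2^k}"]) simp
  qed
  then show ?thesis by metis
qed

end
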